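(* Let $\mu=\sum_{k=1}^{K}a_k\mu_k$ and $\nu=\sum_{l=1}^{L}b_l\nu_l$ be Gaussian mixtures on $\mathbb{R}^d$, where $a_k>0$, $b_l>0$, $\sum_k a_k=\sum_l b_l=1$, and $\mu_k=\mathcal N(m_{0,k},\Sigma_{0,k})$, $\nu_l=\mathcal N(m_{1,l},\Sigma_{1,l})$ are Gaussian probability measures with positive definite covariance matrices. Let $c_{kl}=W_2^2(\mu_k,\nu_l)$. For $\varepsilon,\lambda>0$ let $\omega^{\varepsilon,\lambda}$ be the real--real block (upper-left $K\times L$ block) of the minimizer of the entropic partial optimal transport problem for the weight vectors $a,b$ with cost matrix $(c_{kl})$, and let $\gamma^{\varepsilon,\lambda}=\gamma_{\omega^{\varepsilon,\lambda}}$ be the induced transport plan. Let $\omega^*$ be the unique maximum-entropy minimizer in the mixture Wasserstein problem $\min_{\omega\in\Pi(a,b)}\sum_{k=1}^{K}\sum_{l=1}^{L}W_2^2(\mu_k,\nu_l)\omega_{kl}$, and let $\gamma^*=\gamma_{\omega^*}$. Then for every $\varphi\in C_b(\mathbb{R}^d\times\mathbb{R}^d)$, $$\lim_{\varepsilon\to0}\lim_{\lambda\to\infty}\int_{\mathbb{R}^d\times\mathbb{R}^d}\varphi(x,y)\,\mathrm{d}\gamma^{\varepsilon,\lambda}(x,y)=\int_{\mathbb{R}^d\times\mathbb{R}^d}\varphi(x,y)\,\mathrm{d}\gamma^{*}(x,y).$$ Thus $\lim_{\varepsilon\to0}\lim_{\lambda\to\infty}\gamma^{\varepsilon,\lambda}=\gamma^*$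 in the sense of narrow convergence.
   Context: $W_2$ is the $2$-Wasserstein distance for the Euclidean distance. For nonnegative vectors $r,s$ of equal total mass, $\Pi(r,s)$ is the set of nonnegative matrices with row sums $r$ and column sums $s$. For a nonnegative matrix $A$, $E(A)=\sum_{i,j}A_{ij}(\log A_{ij}-1)$, with $0\log 0=0$. Put $a=(a_1,\dots,a_K)$, $b=(b_1,\dots,b_L)$, $\widetilde a=(a_1,\dots,a_K,1)$, $\widetilde b=(b_1,\dots,b_L,1)$, and $\widetilde c^{\lambda}_{kl}=c_{kl}-2\lambda$ for $1\le k\le K$, $1\le l\le L$, $\widetilde c^{\lambda}_{kl}=0$ if $k=K+1$ or $l=L+1$. The entropic partial optimal transport (EPOT) problem is $$\min_{\Gamma\in\Pi(\widetilde a,\widetilde b)}\left\{\sum_{k=1}^{K+1}\sum_{l=1}^{L+1}\widetilde c^{\lambda}_{kl}\Gamma_{kl}+\varepsilon E(\Gamma)+2\lambda\right\};$$ it has a unique minimizer. The maximum-entropy minimizer $\omega^*$ is the unique maximizer of $-E$ over the (nonempty, compact, convex) set $\mathcal S=\operatorname{arg\,min}_{\omega\in\Pi(a,b)}\sum_{k,l}W_2^2(\mu_k,\nu_l)\omega_{kl}$. The optimal transport map from $\mu_k$ to $\nu_l$ is $$T_{kl}(x)=m_{1,l}+A_{kl}(x-m_{0,k}),\qquad A_{kl}=\Sigma_{0,k}^{-1/2}\bigl(\Sigma_{0,k}^{1/2}\Sigma_{1,l}\Sigma_{0,k}^{1/2}\bigr)^{1/2}\Sigma_{0,k}^{-1/2}.$$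 For a nonnegative $K\times L$ matrix $\omega$ with row sums at most $a$ and column sums at most $b$ (componentwise), the induced plan is the finite measure $\gamma_\omega=\sum_{k=1}^{K}\sum_{l=1}^{L}\omega_{kl}(\mathrm{Id},T_{kl})_\#\mu_k$ on $\mathbb{R}^d\times\mathbb{R}^d$. $C_b$ denotes bounded continuous real functions; narrow convergence means convergence of integrals against all such functions. The limit $\varepsilon\to0$ is through $\varepsilon>0$. *)

theory Defs
  imports "HOL-Analysis.Analysis"
begin

definition pos_def_matrix :: "real^'n^'n \<Rightarrow> bool" where
  "pos_def_matrix S \<longleftrightarrow> transpose S = S \<and> (\<forall>x. x \<noteq> 0 \<longrightarrow> x \<bullet> (S *v x) > 0)"

definition pos_semidef_matrix :: "real^'n^'n \<Rightarrow> bool" where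
  "pos_semidef_matrix S \<longleftrightarrow> transpose S = S \<and> (\<forall>x. x \<bullet> (S *v x) \<ge> 0)"

text \<open>The principal square root; it exists and is unique for positive semidefinite \<open>S\<close>, and
  the value for other \<open>S\<close> is irrelevant.\<close>
definition matrix_sqrt :: "real^'n^'n \<Rightarrow> real^'n^'n" where
  "matrix_sqrt S = (THE R. pos_semidef_matrix R \<and> R ** R = S)"

text \<open>The normal distribution with mean \<open>m\<close> and positive definite covariance matrix \<open>S\<close>.\<close>
definition gaussian :: "real^'n \<Rightarrow> real^'n^'n \<Rightarrow> (real^'n) measure" where
  "gaussian m S = density lborel (\<lambda>x. ennreal
     (exp (- ((x - m) \<bullet> (matrix_inv S *v (x - m))) / 2) / sqrt ((2 * pi) ^ CARD('n) * det S)))"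

text \<open>The finite combination \<open>\<Sum>\<^sub>i w\<^sub>i M\<^sub>i\<close> of Borel measures, for nonnegative weights.\<close>
definition mixture :: "('i::finite \<Rightarrow> real) \<Rightarrow> ('i \<Rightarrow> 'a::topological_space measure) \<Rightarrow> 'a measure" where
  "mixture w M = measure_of UNIV (sets borel) (\<lambda>B. \<Sum>i\<in>UNIV. ennreal (w i) * emeasure (M i) B)"

lemma space_mixture [simp]: "space (mixture w M) = UNIV"
  by (simp add: mixture_def space_measure_of_conv)

lemma sets_mixture [simp, measurable_cong]: "sets (mixture w M) = sets borel"
  unfolding mixture_def using sets.sigma_sets_eq[of borel] by (simp add: sets_measure_of_conv)

lemma emeasure_mixture:
  fixes M :: "'i::finite \<Rightarrow> 'a::topological_space measure"
  assumes M: "\<And>i. sets (M i) = sets borel" and B: "B \<in> sets borel"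
  shows "emeasure (mixture w M) B = (\<Sum>i\<in>UNIV. ennreal (w i) * emeasure (M i) B)"
  unfolding mixture_def
proof (rule emeasure_measure_of_sigma)
  show "sigma_algebra UNIV (sets (borel :: 'a measure))"
    using sets.sigma_algebra_axioms[of "borel :: 'a measure"] by simp
  show "positive (sets borel) (\<lambda>B. \<Sum>i\<in>UNIV. ennreal (w i) * emeasure (M i) B)"
    by (simp add: positive_def)
  show "countably_additive (sets borel) (\<lambda>B. \<Sum>i\<in>UNIV. ennreal (w i) * emeasure (M i) B)"
  proof (rule countably_additiveI)
    fix A :: "nat \<Rightarrow> 'a set"
    assume A: "range A \<subseteq> sets borel" "disjoint_family A"
    have "(\<Sum>n. \<Sum>i\<in>UNIV. ennreal (w i) * emeasure (M i) (A n))
        = (\<Sum>i\<in>UNIV. \<Sum>n. ennreal (w i) * emeasure (M i) (A n))"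
      by (rule suminf_sum) simp
    also have "\<dots> = (\<Sum>i\<in>UNIV. ennreal (w i) * emeasure (M i) (\<Union>n. A n))"
      using A by (simp add: suminf_emeasure M)
    finally show "(\<Sum>n. \<Sum>i\<in>UNIV. ennreal (w i) * emeasure (M i) (A n))
        = (\<Sum>i\<in>UNIV. ennreal (w i) * emeasure (M i) (\<Union>n. A n))" .
  qed
  show "B \<in> sets borel" by (fact B)
qed

definition couplings :: "'a::topological_space measure \<Rightarrow> 'a measure \<Rightarrow> ('a \<times> 'a) measure set" where
  "couplings \<mu> \<nu> = {\<pi>. sets \<pi> = sets borel \<and> distr \<pi> borel fst = \<mu> \<and> distr \<pi> borel snd = \<nu>}"

text \<open>A real number, hence only meaningful when the infimum is finite, e.g. for probability
  measures with finite second moments.\<close>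
definition W2 :: "'a::euclidean_space measure \<Rightarrow> 'a measure \<Rightarrow> real" where
  "W2 \<mu> \<nu> = sqrt (enn2real (INF \<pi>\<in>couplings \<mu> \<nu>. \<integral>\<^sup>+z. ennreal ((dist (fst z) (snd z))\<^sup>2) \<partial>\<pi>))"

definition transport_polytope :: "real^'i \<Rightarrow> real^'j \<Rightarrow> (real^'j^'i) set" where
  "transport_polytope r s = {G. (\<forall>i j. G $ i $ j \<ge> 0) \<and>
     (\<forall>i. (\<Sum>j\<in>UNIV. G $ i $ j) = r $ i) \<and> (\<forall>j. (\<Sum>i\<in>UNIV. G $ i $ j) = s $ j)}"

text \<open>Here \<open>ln 0 = 0\<close>, so the convention \<open>0 log 0 = 0\<close> holds.\<close>
definition entropy_functional :: "real^'j^'i \<Rightarrow> real" where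
  "entropy_functional A = (\<Sum>i\<in>UNIV. \<Sum>j\<in>UNIV. A $ i $ j * (ln (A $ i $ j) - 1))"

definition transport_cost :: "real^'j^'i \<Rightarrow> real^'j^'i \<Rightarrow> real" where
  "transport_cost c G = (\<Sum>i\<in>UNIV. \<Sum>j\<in>UNIV. c $ i $ j * G $ i $ j)"

text \<open>The dummy index \<open>K + 1\<close> (resp. \<open>L + 1\<close>) is \<open>None\<close>.\<close>
definition extend_weights :: "real^'k \<Rightarrow> real^('k option)" where
  "extend_weights a = (\<chi> i. case i of None \<Rightarrow> 1 | Some k \<Rightarrow> a $ k)"

definition extend_cost :: "real \<Rightarrow> real^'l^'k \<Rightarrow> real^('l option)^('k option)" where
  "extend_cost lam c = (\<chi> i j. case (i, j) of (Some k, Some l) \<Rightarrow> c $ k $ l - 2 * lam | _ \<Rightarrow> 0)"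

definition epot_objective ::
  "real^'l^'k \<Rightarrow> real \<Rightarrow> real \<Rightarrow> real^('l option)^('k option) \<Rightarrow> real" where
  "epot_objective c \<epsilon> lam G =
     transport_cost (extend_cost lam c) G + \<epsilon> * entropy_functional G + 2 * lam"

definition epot_minimizer ::
  "real^'k \<Rightarrow> real^'l \<Rightarrow> real^'l^'k \<Rightarrow> real \<Rightarrow> real \<Rightarrow> real^('l option)^('k option)" where
  "epot_minimizer a b c \<epsilon> lam = arg_min_on (epot_objective c \<epsilon> lam)
     (transport_polytope (extend_weights a) (extend_weights b))"

definition epot_real_block ::
  "real^'k \<Rightarrow> real^'l \<Rightarrow> real^'l^'k \<Rightarrow> real \<Rightarrow> real \<Rightarrow> real^'l^'k" where
  "epot_real_block a b c \<epsilon> lam = (\<chi> k l. epot_minimizer a b c \<epsilon> lam $ Some k $ Some l)"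

definition ot_minimizers :: "real^'k \<Rightarrow> real^'l \<Rightarrow> real^'l^'k \<Rightarrow> (real^'l^'k) set" where
  "ot_minimizers a b c =
     {\<omega>. is_arg_min (transport_cost c) (\<lambda>\<omega>. \<omega> \<in> transport_polytope a b) \<omega>}"

definition max_entropy_minimizer :: "real^'k \<Rightarrow> real^'l \<Rightarrow> real^'l^'k \<Rightarrow> real^'l^'k" where
  "max_entropy_minimizer a b c =
     (ARG_MAX (\<lambda>\<omega>. - entropy_functional \<omega>) \<omega>. \<omega> \<in> ot_minimizers a b c)"

definition gaussian_map ::
  "real^'n \<Rightarrow> real^'n^'n \<Rightarrow> real^'n \<Rightarrow> real^'n^'n \<Rightarrow> real^'n \<Rightarrow> real^'n" where
  "gaussian_map m0 S0 m1 S1 x =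
     (let R = matrix_sqrt S0; R' = matrix_inv R
      in m1 + (R' ** matrix_sqrt (R ** S1 ** R) ** R') *v (x - m0))"

definition induced_plan ::
  "('k::finite \<Rightarrow> real^'n) \<Rightarrow> ('k \<Rightarrow> real^'n^'n) \<Rightarrow> ('l::finite \<Rightarrow> real^'n) \<Rightarrow> ('l \<Rightarrow> real^'n^'n)
     \<Rightarrow> real^'l^'k \<Rightarrow> ((real^'n) \<times> (real^'n)) measure" where
  "induced_plan m0 S0 m1 S1 \<omega> = mixture (\<lambda>(k, l). \<omega> $ k $ l)
     (\<lambda>(k, l). distr (gaussian (m0 k) (S0 k)) borel
        (\<lambda>x. (x, gaussian_map (m0 k) (S0 k) (m1 l) (S1 l) x)))"

definition narrowly_tendsto ::
  "('i \<Rightarrow> 'a::topological_space measure) \<Rightarrow> 'a measure \<Rightarrow> 'i filter \<Rightarrow> bool" where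
  "narrowly_tendsto M N F \<longleftrightarrow> (\<forall>\<phi> :: 'a \<Rightarrow> real. continuous_on UNIV \<phi> \<longrightarrow> bounded (range \<phi>)
     \<longrightarrow> ((\<lambda>i. \<integral>z. \<phi> z \<partial>M i) \<longlongrightarrow> (\<integral>z. \<phi> z \<partial>N)) F)"

end

theory Submission
  imports Defs "HOL-Probability.Distributions" "HOL-Real_Asymp.Real_Asymp"
begin

text \<open>
  Both limits are penalty limits: if \<open>g + r h\<close> is minimised over a compact set with \<open>h \<ge> 0\<close> and
  \<open>r \<longrightarrow> \<infinity>\<close>, the minimisers converge to the minimiser of \<open>g\<close> on \<open>{h = 0}\<close> whenever that one is
  unique. For \<open>\<lambda> \<longrightarrow> \<infinity>\<close> take \<open>r = \<lambda>\<close> and \<open>h\<close> twice the mass missing from the real--real block;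
  \<open>{h = 0}\<close> is then a copy of \<open>\<Pi>(a, b)\<close>, with the entropically regularised transport problem on
  it. For \<open>\<epsilon> \<longrightarrow> 0\<close> take \<open>r = 1/\<epsilon>\<close>, \<open>g = E\<close> and \<open>h\<close> the excess transport cost. Uniqueness comes
  from strict convexity of \<open>E\<close>. For a fixed bounded test function the integral
  against the induced plan is linear in the finitely many weights, so convergence of weights gives
  narrow convergence.
\<close>

section \<open>Penalised minimisation\<close>

text \<open>Away from \<open>x0\<close>, compactness keeps \<open>max (h z) (g z - g x0)\<close>
  above some \<eta> > 0. Once \<open>r\<close> is positive, a point there with penalised value at
  most \<open>g x0\<close> must have \<open>h\<close> at least \<eta>, and a large \<open>r\<close>
  makes that too expensive. Only comparison with \<open>x0\<close> is asked of \<open>x t\<close>,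
  and the filter is arbitrary, so limits at infinity and at 0 from the right are both
  instances.\<close>

lemma penalty_minimizers_tendsto:
  fixes g h :: "'a::metric_space \<Rightarrow> real"
  assumes K: "compact K" and g: "continuous_on K g" and h: "continuous_on K h"
    and h_nonneg: "\<And>z. z \<in> K \<Longrightarrow> 0 \<le> h z"
    and x0: "x0 \<in> K"
    and strict: "\<And>z. z \<in> K \<Longrightarrow> h z = 0 \<Longrightarrow> z \<noteq> x0 \<Longrightarrow> g x0 < g z"
    and r: "filterlim r at_top F"
    and x: "\<forall>\<^sub>F t in F. x t \<in> K \<and> g (x t) + r t * h (x t) \<le> g x0"
  shows "(x \<longlongrightarrow> x0) F"
proof (rule tendstoI)
  fix d :: real assume "d > 0"
  define C where "C = K - ball x0 d"
  have C: "compact C" unfolding C_def by (intro compact_diff K open_ball)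
  show "\<forall>\<^sub>F t in F. dist (x t) x0 < d"
  proof (cases "C = {}")
    case True
    then have "K \<subseteq> ball x0 d" by (auto simp: C_def)
    with x show ?thesis
      by (auto elim!: eventually_mono simp: dist_commute)
  next
    case False
    have "continuous_on C (\<lambda>z. max (h z) (g z - g x0))"
      by (intro continuous_intros continuous_on_subset[OF g] continuous_on_subset[OF h])
        (auto simp: C_def)
    from continuous_attains_inf[OF C False this] obtain y where
      y: "y \<in> C" "\<And>z. z \<in> C \<Longrightarrow> max (h y) (g y - g x0) \<le> max (h z) (g z - g x0)" by blast
    define \<eta> where "\<eta> = max (h y) (g y - g x0)"
    have "y \<in> K" "y \<noteq> x0" using y(1) \<open>d > 0\<close> by (auto simp: C_def)
    \<comment> \<open>A point of \<open>K\<close> other than \<open>x0\<close> has positive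
      \<open>h\<close> or strictly larger \<open>g\<close>.\<close>
    then have \<eta>: "\<eta> > 0" using h_nonneg[of y] strict[of y] by (cases "h y = 0") (auto simp: \<eta>_def less_max_iff_disj)
    obtain m where m: "\<And>z. z \<in> K \<Longrightarrow> m \<le> g z"
      using continuous_attains_inf[OF K _ g] x0 by blast
    \<comment> \<open>Past this threshold the penalty \<open>r t * \<eta>\<close> exceeds
      \<open>g x0 - m\<close>, a bound on how far \<open>g\<close> can drop below
      \<open>g x0\<close> on \<open>K\<close>.\<close>
    have "\<forall>\<^sub>F t in F. r t > max 0 ((g x0 - m) / \<eta>)"
      using r unfolding filterlim_at_top_dense by blast
    with x show ?thesis
    proof eventually_elim
      case (elim t)
      show ?case
      proof (rule ccontr)
        assume "\<not> ?case"
        with elim have tC: "x t \<in> C" by (auto simp: C_def dist_commute)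
        have r0: "r t > 0" "(g x0 - m) / \<eta> < r t" using elim by auto
        have "0 \<le> r t * h (x t)" using r0 h_nonneg elim by auto
        then have "g (x t) - g x0 \<le> 0" using elim by auto
        then have "\<eta> \<le> h (x t)" using y(2)[OF tC] \<eta> by (auto simp: \<eta>_def)
        then have "r t * \<eta> \<le> r t * h (x t)" using r0 by simp
        moreover have "g x0 - m < r t * \<eta>" using r0 \<eta> by (simp add: divide_simps)
        ultimately show False using elim m[of "x t"] by linarith
      qed
    qed
  qed
qed

section \<open>Entropic transport\<close>

lemma tendsto_x_ln_x_at_right_0: "((\<lambda>x::real. x * ln x) \<longlongrightarrow> 0) (at_right 0)"
  by real_asymp

lemma continuous_on_x_ln_x: "continuous_on {0..} (\<lambda>x::real. x * ln x)"
proof (rule continuous_on_eq_continuous_within[THEN iffD2], rule ballI)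
  fix x :: real assume "x \<in> {0..}"
  show "continuous (at x within {0..}) (\<lambda>x. x * ln x)"
  proof (cases "x = 0")
    case True
    \<comment> \<open>At 0 the limit is one-sided, and the value to be matched is
      \<open>0 * ln 0 = 0\<close>.\<close>
    have "(at (0::real) within {0..}) = at_right 0"
      by (simp add: at_within_def) (metis atLeast_def greaterThan_def Diff_insert_absorb insert_Diff
          ivl_disj_un_singleton(1) greaterThan_iff less_irrefl Un_insert_left sup_bot_left)
    then show ?thesis using True tendsto_x_ln_x_at_right_0 by (simp add: continuous_within)
  next
    case False
    then show ?thesis by (auto intro!: continuous_intros)
  qed
qed

text \<open>Strict convexity as a tangent inequality: \<open>ln m\<close> is the slope of
  \<open>x * (ln x - 1)\<close> at \<open>m\<close>. For positive \<open>x\<close> the claim reduces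
  to \<open>ln u < u - 1\<close> at \<open>u = m / x\<close>, which differs from 1; at
  \<open>x = 0\<close> the left side is \<open>- m\<close>.\<close>

lemma x_ln_x_tangent_less:
  fixes x m :: real
  assumes "0 \<le> x" "0 < m" "x \<noteq> m"
  shows "m * (ln m - 1) + ln m * (x - m) < x * (ln x - 1)"
proof (cases "x = 0")
  case True
  then show ?thesis using assms by (simp add: algebra_simps)
next
  case False
  then have "x > 0" using assms by simp
  have "ln (m / x) < m / x - 1"
    using ln_le_minus_one[of "m / x"] ln_eq_minus_one[of "m / x"] \<open>x > 0\<close> assms
    by (force simp: less_le)
  then have "x * ln (m / x) < x * (m / x - 1)" using \<open>x > 0\<close> by simp
  then show ?thesis using \<open>x > 0\<close> assms by (simp add: ln_div algebra_simps)
qed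

text \<open>The midpoint of distinct nonnegative numbers is positive, so its tangent can be compared
  with both ends; the first-order terms cancel.\<close>

lemma x_ln_x_midpoint_less:
  fixes x y :: real
  assumes "0 \<le> x" "0 \<le> y" "x \<noteq> y"
  shows "((x + y) / 2) * (ln ((x + y) / 2) - 1) < (x * (ln x - 1) + y * (ln y - 1)) / 2"
proof -
  define m where "m = (x + y) / 2"
  have "0 < m" "x \<noteq> m" "y \<noteq> m" using assms by (auto simp: m_def)
  from x_ln_x_tangent_less[OF assms(1) this(1,2)] x_ln_x_tangent_less[OF assms(2) this(1,3)]
  have "2 * (m * (ln m - 1)) + ln m * ((x - m) + (y - m)) < x * (ln x - 1) + y * (ln y - 1)"
    by (simp add: algebra_simps)
  moreover have "(x - m) + (y - m) = 0" by (simp add: m_def)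
  ultimately show ?thesis by (simp add: m_def[symmetric])
qed

text \<open>Entrywise midpoint convexity, strict at an entry where the matrices differ. This form of
  strict convexity excludes two minimisers on a convex set.\<close>

lemma entropy_functional_midpoint_less:
  fixes A B :: "real^'j^'i"
  assumes A: "\<And>i j. 0 \<le> A $ i $ j" and B: "\<And>i j. 0 \<le> B $ i $ j" and "A \<noteq> B"
  shows "entropy_functional ((1/2) *\<^sub>R (A + B)) < (entropy_functional A + entropy_functional B) / 2"
proof -
  let ?f = "\<lambda>x::real. x * (ln x - 1)"
  have le: "?f ((A$i$j + B$i$j) / 2) \<le> (?f (A$i$j) + ?f (B$i$j)) / 2" for i j
    using x_ln_x_midpoint_less[OF A[of i j] B[of i j]] by (cases "A$i$j = B$i$j") auto
  obtain i j where ij: "A$i$j \<noteq> B$i$j" using \<open>A \<noteq> B\<close> by (metis vec_eq_iff)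
  have "(\<Sum>i\<in>UNIV. \<Sum>j\<in>UNIV. ?f ((A$i$j + B$i$j) / 2))
      < (\<Sum>i\<in>UNIV. \<Sum>j\<in>UNIV. (?f (A$i$j) + ?f (B$i$j)) / 2)"
  proof (rule sum_strict_mono_ex1)
    show "\<exists>i\<in>UNIV. (\<Sum>j\<in>UNIV. ?f ((A$i$j + B$i$j) / 2))
        < (\<Sum>j\<in>UNIV. (?f (A$i$j) + ?f (B$i$j)) / 2)"
      using x_ln_x_midpoint_less[OF A B ij] le
      by (intro bexI[of _ i] sum_strict_mono_ex1) auto
  qed (use le in \<open>auto intro!: sum_mono simp del: times_divide_eq_left\<close>)
  also have "\<dots> = (entropy_functional A + entropy_functional B) / 2"
    by (simp only: entropy_functional_def sum.distrib sum_divide_distrib[symmetric])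
  finally show ?thesis by (simp add: entropy_functional_def)
qed

lemma continuous_on_entropy_functional:
  "continuous_on {A :: real^'j^'i. \<forall>i j. 0 \<le> A $ i $ j} entropy_functional"
proof -
  have cont: "continuous_on {A :: real^'j^'i. \<forall>i j. 0 \<le> A $ i $ j} (\<lambda>A. A$i$j * ln (A$i$j))" for i j
    by (rule continuous_on_compose2[OF continuous_on_x_ln_x]) (auto intro!: continuous_intros)
  show ?thesis
    unfolding entropy_functional_def right_diff_distrib
    by (intro continuous_on_sum continuous_on_diff cont; intro continuous_intros)
qed

section \<open>Linear cost, transport polytopes, and the unique entropic minimiser\<close>

lemma continuous_on_transport_cost: "continuous_on S (transport_cost c)"
  unfolding transport_cost_def by (intro continuous_intros)

lemma transport_cost_midpoint:
  "transport_cost c ((1/2) *\<^sub>R (A + B)) = (transport_cost c A + transport_cost c B) / 2"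
  by (simp add: transport_cost_def sum.distrib sum_divide_distrib[symmetric] distrib_left)

lemma transport_cost_convex_combination:
  "transport_cost c (u *\<^sub>R A + v *\<^sub>R B) = u * transport_cost c A + v * transport_cost c B"
  by (simp add: transport_cost_def sum.distrib sum_distrib_left algebra_simps)

lemma transport_polytope_nonneg: "G \<in> transport_polytope r s \<Longrightarrow> 0 \<le> G $ i $ j"
  by (simp add: transport_polytope_def)

lemma closed_transport_polytope: "closed (transport_polytope r s)"
  unfolding transport_polytope_def
  by (intro closed_Collect_conj closed_Collect_all closed_Collect_le closed_Collect_eq
      continuous_intros)

lemma compact_transport_polytope:
  fixes r :: "real^'i" and s :: "real^'j"
  shows "compact (transport_polytope r s)"
proof -
  \<comment> \<open>The Euclidean norm is at most the sum of the absolute entries, which for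
    nonnegative entries is the total mass.\<close>
  have "norm G \<le> (\<Sum>i\<in>UNIV. r $ i)" if G: "G \<in> transport_polytope r s" for G
  proof -
    have "norm G \<le> (\<Sum>i\<in>UNIV. norm (G $ i))"
      unfolding norm_vec_def by (rule L2_set_le_sum) auto
    also have "\<dots> \<le> (\<Sum>i\<in>UNIV. \<Sum>j\<in>UNIV. \<bar>G $ i $ j\<bar>)"
      by (intro sum_mono norm_le_l1_cart)
    also have "\<dots> = (\<Sum>i\<in>UNIV. r $ i)" using G by (simp add: transport_polytope_def)
    finally show ?thesis .
  qed
  then show ?thesis
    by (auto simp: compact_eq_bounded_closed closed_transport_polytope bounded_iff)
qed

lemma convex_transport_polytope: "convex (transport_polytope r s)"
  unfolding convex_def transport_polytope_def
  by (auto simp: sum.distrib sum_distrib_left[symmetric] distrib_right[symmetric])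

lemma transport_polytope_nonempty:
  assumes "\<And>i. 0 \<le> r $ i" "\<And>j. 0 \<le> s $ j" "(\<Sum>i\<in>UNIV. r $ i) = 1" "(\<Sum>j\<in>UNIV. s $ j) = 1"
  shows "transport_polytope r s \<noteq> {}"
proof -
  have "(\<chi> i j. r $ i * s $ j) \<in> transport_polytope r s"
    using assms by (simp add: transport_polytope_def sum_distrib_left[symmetric]
        sum_distrib_right[symmetric])
  then show ?thesis by blast
qed

text \<open>A second minimiser would give a midpoint in \<open>S\<close> of smaller value, as the
  cost is linear and the entropy strictly convex. \<open>S\<close> is kept abstract so that it can
  be the whole polytope or, with zero cost, the set of optimal plans.\<close>

lemma entropic_minimizer_unique:
  fixes c :: "real^'j^'i"
  assumes S: "compact S" "convex S" "S \<noteq> {}"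
    and nonneg: "\<And>G i j. G \<in> S \<Longrightarrow> 0 \<le> G $ i $ j" and "\<epsilon> > 0"
  obtains x where "x \<in> S" "\<And>z. z \<in> S \<Longrightarrow> z \<noteq> x \<Longrightarrow>
    transport_cost c x + \<epsilon> * entropy_functional x < transport_cost c z + \<epsilon> * entropy_functional z"
proof -
  let ?f = "\<lambda>G. transport_cost c G + \<epsilon> * entropy_functional G"
  have "continuous_on S ?f"
    using nonneg
    by (intro continuous_intros continuous_on_transport_cost
        continuous_on_subset[OF continuous_on_entropy_functional]) auto
  from continuous_attains_inf[OF S(1,3) this] obtain x where
    x: "x \<in> S" "\<And>z. z \<in> S \<Longrightarrow> ?f x \<le> ?f z" by blast
  have "?f x < ?f z" if z: "z \<in> S" "z \<noteq> x" for z
  proof -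
    let ?m = "(1/2) *\<^sub>R (x + z)"
    have "?m \<in> S" using convexD[OF S(2) x(1) z(1), of "1/2" "1/2"] by (simp add: scaleR_add_right)
    then have "?f x \<le> ?f ?m" by (rule x(2))
    also have "\<dots> < (?f x + ?f z) / 2"
    proof -
      have "entropy_functional ?m < (entropy_functional x + entropy_functional z) / 2"
        using nonneg x(1) z by (intro entropy_functional_midpoint_less) auto
      from mult_strict_left_mono[OF this \<open>\<epsilon> > 0\<close>] show ?thesis
        unfolding transport_cost_midpoint by (simp add: distrib_left add_divide_distrib)
    qed
    finally show ?thesis by (simp add: field_simps)
  qed
  with x(1) show thesis by (rule that)
qed

section \<open>Optimal plans, the one of maximal entropy, and the limit \<epsilon> \<rightarrow>
  0\<close>

lemma ot_minimizers_eq: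
  "ot_minimizers a b c = {\<omega> \<in> transport_polytope a b.
     \<forall>z\<in>transport_polytope a b. transport_cost c \<omega> \<le> transport_cost c z}"
  by (auto simp: ot_minimizers_def is_arg_min_linorder)

text \<open>The optimal plans are the polytope cut by a closed sublevel set of the linear cost, at
  the minimal value.\<close>

lemma ot_minimizers_compact_convex_nonempty:
  assumes "transport_polytope a b \<noteq> {}"
  shows "compact (ot_minimizers a b c)" "convex (ot_minimizers a b c)" "ot_minimizers a b c \<noteq> {}"
proof -
  obtain x where x: "x \<in> transport_polytope a b"
    "\<And>z. z \<in> transport_polytope a b \<Longrightarrow> transport_cost c x \<le> transport_cost c z"
    using continuous_attains_inf[OF compact_transport_polytope assms continuous_on_transport_cost]
    by blast
  have eq: "ot_minimizers a b c = transport_polytope a b \<inter>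
      {G. transport_cost c G \<le> transport_cost c x}"
    using x by (force simp: ot_minimizers_eq)
  show "compact (ot_minimizers a b c)"
    unfolding eq
    by (intro compact_Int_closed compact_transport_polytope closed_Collect_le
        continuous_on_transport_cost continuous_intros)
  have "convex {G. transport_cost c G \<le> transport_cost c x}"
    by (auto simp: convex_def transport_cost_convex_combination intro: convex_bound_le)
  then show "convex (ot_minimizers a b c)"
    unfolding eq by (intro convex_Int convex_transport_polytope)
  show "ot_minimizers a b c \<noteq> {}" using x by (auto simp: ot_minimizers_eq)
qed

text \<open>\<open>entropic_minimizer_unique\<close> on the set of optimal plans, with zero cost and
  \<epsilon> = 1; uniqueness identifies the point chosen by \<open>ARG_MAX\<close>.\<close>

lemma max_entropy_minimizer_strict:
  assumes ne: "transport_polytope a b \<noteq> {}"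
  shows "max_entropy_minimizer a b c \<in> ot_minimizers a b c"
    and "\<And>z. z \<in> ot_minimizers a b c \<Longrightarrow> z \<noteq> max_entropy_minimizer a b c \<Longrightarrow>
      entropy_functional (max_entropy_minimizer a b c) < entropy_functional z"
proof -
  have nonneg: "0 \<le> G $ i $ j" if "G \<in> ot_minimizers a b c" for G i j
    using that by (auto simp: ot_minimizers_eq intro: transport_polytope_nonneg)
  obtain x where x: "x \<in> ot_minimizers a b c"
    "\<And>z. z \<in> ot_minimizers a b c \<Longrightarrow> z \<noteq> x \<Longrightarrow> entropy_functional x < entropy_functional z"
    by (rule entropic_minimizer_unique[OF ot_minimizers_compact_convex_nonempty[OF ne, of c],
          where \<epsilon>=1 and c=0]) (auto simp: nonneg transport_cost_def)
  have "is_arg_max (\<lambda>\<omega>. - entropy_functional \<omega>) (\<lambda>\<omega>. \<omega> \<in> ot_minimizers a b c) y \<longleftrightarrow> y = x" for y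
    using x by (auto simp: is_arg_max_def) (metis less_asym less_irrefl)+
  then have "max_entropy_minimizer a b c = x"
    unfolding max_entropy_minimizer_def arg_max_def by (intro some_equality) auto
  then show "max_entropy_minimizer a b c \<in> ot_minimizers a b c"
    and "\<And>z. z \<in> ot_minimizers a b c \<Longrightarrow> z \<noteq> max_entropy_minimizer a b c \<Longrightarrow>
      entropy_functional (max_entropy_minimizer a b c) < entropy_functional z"
    using x by auto
qed

text \<open>Dividing the objective by \<epsilon> turns it, up to a constant, into entropy plus
  1/\<epsilon> times the excess cost, and the excess vanishes exactly on the optimal plans.\<close>

lemma entropic_ot_tendsto_max_entropy:
  assumes ne: "transport_polytope a b \<noteq> {}"
    and x: "\<And>\<epsilon>. \<epsilon> > 0 \<Longrightarrow> x \<epsilon> \<in> transport_polytope a b"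
    and min: "\<And>\<epsilon> z. \<epsilon> > 0 \<Longrightarrow> z \<in> transport_polytope a b \<Longrightarrow>
      transport_cost c (x \<epsilon>) + \<epsilon> * entropy_functional (x \<epsilon>)
        \<le> transport_cost c z + \<epsilon> * entropy_functional z"
  shows "(x \<longlongrightarrow> max_entropy_minimizer a b c) (at_right 0)"
proof -
  let ?w = "max_entropy_minimizer a b c"
  note w = max_entropy_minimizer_strict[OF ne, where c=c]
  have wP: "?w \<in> transport_polytope a b"
    and wmin: "\<And>z. z \<in> transport_polytope a b \<Longrightarrow> transport_cost c ?w \<le> transport_cost c z"
    using w(1) by (auto simp: ot_minimizers_eq)
  show ?thesis
  proof (rule penalty_minimizers_tendsto[OF compact_transport_polytope, of _ _ _
        "\<lambda>z. transport_cost c z - transport_cost c ?w"])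
    show "continuous_on (transport_polytope a b) entropy_functional"
      by (rule continuous_on_subset[OF continuous_on_entropy_functional])
        (auto intro: transport_polytope_nonneg)
    show "continuous_on (transport_polytope a b) (\<lambda>z. transport_cost c z - transport_cost c ?w)"
      by (intro continuous_intros continuous_on_transport_cost)
    show "entropy_functional ?w < entropy_functional z"
      if "z \<in> transport_polytope a b" "transport_cost c z - transport_cost c ?w = 0" "z \<noteq> ?w" for z
      using that wmin by (intro w(2)) (auto simp: ot_minimizers_eq)
    show "filterlim (\<lambda>\<epsilon>::real. inverse \<epsilon>) at_top (at_right 0)"
      by (rule filterlim_inverse_at_top_right)
    show "\<forall>\<^sub>F \<epsilon> in at_right 0. x \<epsilon> \<in> transport_polytope a b \<and> entropy_functional (x \<epsilon>)
        + inverse \<epsilon> * (transport_cost c (x \<epsilon>) - transport_cost c ?w) \<le> entropy_functional ?w"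
      using eventually_at_right_less[of "0::real"]
    proof eventually_elim
      case (elim \<epsilon>)
      then show ?case using x[OF elim] min[OF elim wP] by (simp add: field_simps)
    qed
  qed (use wP wmin in auto)
qed

section \<open>Removing the dummy points\<close>

text \<open>The dummy marginals are 1, so once the real points exchange no mass with the dummies,
  the dummy pair must carry weight 1.\<close>

definition pad_plan :: "real^'l^'k \<Rightarrow> real^('l option)^('k option)" where
  "pad_plan \<omega> = (\<chi> i j. case (i, j) of (Some k, Some l) \<Rightarrow> \<omega> $ k $ l | (None, None) \<Rightarrow> 1 | _ \<Rightarrow> 0)"

lemma pad_plan_simps [simp]:
  "pad_plan \<omega> $ Some k $ Some l = \<omega> $ k $ l" "pad_plan \<omega> $ None $ None = 1"
  "pad_plan \<omega> $ Some k $ None = 0" "pad_plan \<omega> $ None $ Some l = 0"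
  by (simp_all add: pad_plan_def)

lemma extend_weights_simps [simp]:
  "extend_weights a $ Some k = a $ k" "extend_weights a $ None = 1"
  by (simp_all add: extend_weights_def)

lemma extend_cost_simps [simp]:
  "extend_cost lam c $ Some k $ Some l = c $ k $ l - 2 * lam"
  "extend_cost lam c $ None $ j = 0" "extend_cost lam c $ i $ None = 0"
  by (simp_all add: extend_cost_def split: option.split)

lemma sum_UNIV_option:
  "(\<Sum>i\<in>(UNIV :: 'a::finite option set). f i) = f None + (\<Sum>k\<in>UNIV. f (Some k))"
  by (simp add: UNIV_option_conv sum.reindex)

lemma all_option: "(\<forall>i. P i) \<longleftrightarrow> P None \<and> (\<forall>k. P (Some k))"
  by (metis option.exhaust)

lemma pad_plan_in_transport_polytope:
  "\<omega> \<in> transport_polytope a b \<Longrightarrow>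
    pad_plan \<omega> \<in> transport_polytope (extend_weights a) (extend_weights b)"
  by (simp add: transport_polytope_def all_option sum_UNIV_option)

text \<open>The dummy pair contributes \<open>1 * (ln 1 - 1) = -1\<close> and the zero entries
  nothing.\<close>

lemma entropy_functional_pad_plan:
  "entropy_functional (pad_plan \<omega>) = entropy_functional \<omega> - 1"
  by (simp add: entropy_functional_def sum_UNIV_option)

lemma transport_cost_extend_cost:
  "transport_cost (extend_cost lam c) G = transport_cost c (\<chi> k l. G $ Some k $ Some l)
    - 2 * lam * (\<Sum>k\<in>UNIV. \<Sum>l\<in>UNIV. G $ Some k $ Some l)"
  by (simp add: transport_cost_def sum_UNIV_option left_diff_distrib sum_subtractf sum_distrib_left)

text \<open>Summing the marginal equations over the real rows, or over the real columns, shows that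
  each dummy exchanges with the real points exactly what the real block lacks of mass 1.\<close>

lemma extended_polytope_real_mass:
  assumes G: "G \<in> transport_polytope (extend_weights a) (extend_weights b)"
    and a: "(\<Sum>k\<in>UNIV. a $ k) = 1" and b: "(\<Sum>l\<in>UNIV. b $ l) = 1"
  shows "(\<Sum>k\<in>UNIV. G $ Some k $ None) = 1 - (\<Sum>k\<in>UNIV. \<Sum>l\<in>UNIV. G $ Some k $ Some l)" (is ?r)
    and "(\<Sum>l\<in>UNIV. G $ None $ Some l) = 1 - (\<Sum>k\<in>UNIV. \<Sum>l\<in>UNIV. G $ Some k $ Some l)" (is ?c)
proof -
  have "(\<Sum>k\<in>UNIV. G $ Some k $ None + (\<Sum>l\<in>UNIV. G $ Some k $ Some l)) = (\<Sum>k\<in>UNIV. a $ k)"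
    using G by (simp add: transport_polytope_def all_option sum_UNIV_option)
  then show ?r by (simp add: sum.distrib a)
  have "(\<Sum>l\<in>UNIV. G $ None $ Some l + (\<Sum>k\<in>UNIV. G $ Some k $ Some l)) = (\<Sum>l\<in>UNIV. b $ l)"
    using G by (simp add: transport_polytope_def all_option sum_UNIV_option)
  then show ?c
    using sum.swap[of "\<lambda>k l. G $ Some k $ Some l" UNIV UNIV] by (simp add: sum.distrib b)
qed

text \<open>The nonnegative entries between real points and a dummy sum to the missing mass 0, so
  each vanishes, and the dummy marginal puts weight 1 on the dummy pair.\<close>

lemma full_mass_imp_pad_plan:
  assumes G: "G \<in> transport_polytope (extend_weights a) (extend_weights b)"
    and a: "(\<Sum>k\<in>UNIV. a $ k) = 1" and b: "(\<Sum>l\<in>UNIV. b $ l) = 1"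
    and full: "(\<Sum>k\<in>UNIV. \<Sum>l\<in>UNIV. G $ Some k $ Some l) = 1"
  obtains \<omega> where "\<omega> \<in> transport_polytope a b" "G = pad_plan \<omega>"
proof -
  note nn = transport_polytope_nonneg[OF G]
  have r: "G $ Some k $ None = 0" for k
    using extended_polytope_real_mass(1)[OF G a b] full nn
    by (simp add: sum_nonneg_eq_0_iff)
  have c: "G $ None $ Some l = 0" for l
    using extended_polytope_real_mass(2)[OF G a b] full nn
    by (simp add: sum_nonneg_eq_0_iff)
  have 1: "G $ None $ None = 1"
    using G r by (simp add: transport_polytope_def all_option sum_UNIV_option)
  let ?w = "\<chi> k l. G $ Some k $ Some l"
  have "?w \<in> transport_polytope a b"
    using G r c by (simp add: transport_polytope_def all_option sum_UNIV_option)
  moreover have "G = pad_plan ?w"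
    by (simp add: vec_eq_iff all_option r c 1)
  ultimately show thesis by (rule that)
qed

section \<open>The EPOT minimiser and its limit \<lambda> \<rightarrow> \<infinity>\<close>

lemma continuous_on_epot_objective:
  "continuous_on (transport_polytope r s) (epot_objective c \<epsilon> lam)"
  unfolding epot_objective_def
  by (intro continuous_intros continuous_on_transport_cost
      continuous_on_subset[OF continuous_on_entropy_functional]) (auto intro: transport_polytope_nonneg)

text \<open>Compactness and continuity provide a minimiser, so the choice behind
  \<open>arg_min_on\<close> returns one.\<close>

lemma epot_minimizer_minimizes:
  assumes ne: "transport_polytope a b \<noteq> {}"
  shows "epot_minimizer a b c \<epsilon> lam \<in> transport_polytope (extend_weights a) (extend_weights b)"
    and "\<And>G. G \<in> transport_polytope (extend_weights a) (extend_weights b) \<Longrightarrow>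
      epot_objective c \<epsilon> lam (epot_minimizer a b c \<epsilon> lam) \<le> epot_objective c \<epsilon> lam G"
proof -
  let ?P = "transport_polytope (extend_weights a) (extend_weights b)"
  have "?P \<noteq> {}" using ne pad_plan_in_transport_polytope by fastforce
  from continuous_attains_inf[OF compact_transport_polytope this
      continuous_on_epot_objective[of _ _ c \<epsilon> lam]]
  have "\<exists>x. is_arg_min (epot_objective c \<epsilon> lam) (\<lambda>x. x \<in> ?P) x"
    by (auto simp: is_arg_min_linorder Bex_def)
  then have "is_arg_min (epot_objective c \<epsilon> lam) (\<lambda>x. x \<in> ?P) (epot_minimizer a b c \<epsilon> lam)"
    unfolding epot_minimizer_def arg_min_on_def arg_min_def by (rule someI_ex)
  then show "epot_minimizer a b c \<epsilon> lam \<in> ?P"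
    and "\<And>G. G \<in> ?P \<Longrightarrow>
      epot_objective c \<epsilon> lam (epot_minimizer a b c \<epsilon> lam) \<le> epot_objective c \<epsilon> lam G"
    by (auto simp: is_arg_min_linorder)
qed

lemma epot_minimizer_tendsto:
  fixes a :: "real^'k" and b :: "real^'l"
  assumes a: "(\<Sum>k\<in>UNIV. a $ k) = 1" and b: "(\<Sum>l\<in>UNIV. b $ l) = 1"
    and w: "w \<in> transport_polytope a b"
    and min: "\<And>z. z \<in> transport_polytope a b \<Longrightarrow> z \<noteq> w \<Longrightarrow>
      transport_cost c w + \<epsilon> * entropy_functional w < transport_cost c z + \<epsilon> * entropy_functional z"
  shows "(epot_minimizer a b c \<epsilon> \<longlongrightarrow> pad_plan w) at_top"
proof -
  let ?P = "transport_polytope (extend_weights a) (extend_weights b)"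
  let ?g = "\<lambda>G. transport_cost (extend_cost 0 c) G + \<epsilon> * entropy_functional G"
  let ?h = "\<lambda>G :: real^('l option)^('k option).
    2 * (1 - (\<Sum>k\<in>UNIV. \<Sum>l\<in>UNIV. G $ Some k $ Some l))"
  \<comment> \<open>The shift \<open>- 2 * lam\<close> on the real block and the constant
    \<open>2 * lam\<close> combine to \<open>lam\<close> times twice the missing mass; the rest is
    the objective at \<open>lam = 0\<close>.\<close>
  have obj: "epot_objective c \<epsilon> lam G = ?g G + lam * ?h G" for lam G
    by (simp add: epot_objective_def transport_cost_extend_cost algebra_simps)
  have full: "(\<Sum>k\<in>UNIV. \<Sum>l\<in>UNIV. z $ k $ l) = 1" if "z \<in> transport_polytope a b" for z
    using that a by (simp add: transport_polytope_def)
  \<comment> \<open>The constant \<open>- \<epsilon>\<close> comes from the dummy pair and cancels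
    in comparisons.\<close>
  have g_pad: "?g (pad_plan z) = transport_cost c z + \<epsilon> * entropy_functional z - \<epsilon>" for z
    by (simp add: transport_cost_extend_cost entropy_functional_pad_plan algebra_simps)
  show ?thesis
  proof (rule penalty_minimizers_tendsto[OF compact_transport_polytope, of _ _ ?g ?h])
    show "continuous_on ?P ?g"
      using continuous_on_epot_objective[of "extend_weights a" "extend_weights b" c \<epsilon> 0]
      by (simp add: epot_objective_def[abs_def])
    show "continuous_on ?P ?h" by (intro continuous_intros)
    \<comment> \<open>The missing mass is what the real rows send to the dummy column.\<close>
    show "0 \<le> ?h G" if G: "G \<in> ?P" for G
      using sum_nonneg[of UNIV "\<lambda>k. G $ Some k $ None"] transport_polytope_nonneg[OF G]
        extended_polytope_real_mass(1)[OF G a b] by simp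
    show "pad_plan w \<in> ?P" by (rule pad_plan_in_transport_polytope[OF w])
    show "?g (pad_plan w) < ?g G" if G: "G \<in> ?P" "?h G = 0" "G \<noteq> pad_plan w" for G
    proof -
      obtain z where z: "z \<in> transport_polytope a b" "G = pad_plan z"
        by (rule full_mass_imp_pad_plan[OF G(1) a b]) (use G in auto)
      then show ?thesis using min[of z] G(3) unfolding z(2) g_pad by auto
    qed
    show "\<forall>\<^sub>F lam in at_top. epot_minimizer a b c \<epsilon> lam \<in> ?P \<and>
        ?g (epot_minimizer a b c \<epsilon> lam) + lam * ?h (epot_minimizer a b c \<epsilon> lam) \<le> ?g (pad_plan w)"
    proof (intro always_eventually allI conjI)
      fix lam
      have ne: "transport_polytope a b \<noteq> {}" using w by blast
      note m = epot_minimizer_minimizes[OF ne, where c=c and \<epsilon>=\<epsilon> and lam=lam]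
      show "epot_minimizer a b c \<epsilon> lam \<in> ?P" by (rule m(1))
      show "?g (epot_minimizer a b c \<epsilon> lam) + lam * ?h (epot_minimizer a b c \<epsilon> lam) \<le> ?g (pad_plan w)"
        using m(2)[OF pad_plan_in_transport_polytope[OF w]] unfolding obj by (simp add: full[OF w])
    qed
  qed (rule filterlim_ident)
qed

section \<open>Plans induced by weights\<close>

lemma nn_integral_mixture:
  fixes M :: "'i::finite \<Rightarrow> 'a::topological_space measure"
  assumes M: "\<And>i. sets (M i) = sets borel" and f: "f \<in> borel_measurable borel"
  shows "(\<integral>\<^sup>+x. f x \<partial>mixture w M) = (\<Sum>i\<in>UNIV. ennreal (w i) * (\<integral>\<^sup>+x. f x \<partial>M i))"
  using f
proof (induction rule: borel_measurable_induct)
  case (cong f g)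
  moreover have "g x = f x" for x using cong by auto
  ultimately show ?case by simp
next
  case (set A)
  then show ?case by (simp add: emeasure_mixture M)
next
  case (mult u c)
  then have "u \<in> borel_measurable (mixture w M)" "\<And>i. u \<in> borel_measurable (M i)"
    by (simp_all cong: measurable_cong_sets add: M)
  then show ?case using mult
    by (simp add: nn_integral_cmult sum_distrib_left mult.left_commute)
next
  case (add u v)
  then have "u \<in> borel_measurable (mixture w M)" "\<And>i. u \<in> borel_measurable (M i)"
    "v \<in> borel_measurable (mixture w M)" "\<And>i. v \<in> borel_measurable (M i)"
    by (simp_all cong: measurable_cong_sets add: M)
  then show ?case using add
    by (simp add: nn_integral_add sum.distrib distrib_left)
next
  case (seq U)
  have inc: "incseq U" by (rule seq)
  have meas: "U i \<in> borel_measurable (mixture w M)" "U i \<in> borel_measurable (M j)" for i j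
    using seq.hyps by (simp_all cong: measurable_cong_sets add: M)
  have "(\<integral>\<^sup>+x. (SUP i. U i) x \<partial>mixture w M) = (SUP i. \<integral>\<^sup>+x. U i x \<partial>mixture w M)"
    unfolding SUP_apply by (rule nn_integral_monotone_convergence_SUP[OF inc meas(1)])
  also have "\<dots> = (SUP n. \<Sum>i\<in>UNIV. ennreal (w i) * (\<integral>\<^sup>+x. U n x \<partial>M i))"
    by (simp add: seq.IH)
  \<comment> \<open>Supremum and finite sum commute because every summand increases with
    \<open>n\<close>.\<close>
  also have "\<dots> = (\<Sum>i\<in>UNIV. SUP n. ennreal (w i) * (\<integral>\<^sup>+x. U n x \<partial>M i))"
    by (rule ennreal_SUP_sum)
      (auto intro!: incseq_SucI mult_left_mono nn_integral_mono
        intro: le_funD[OF incseq_SucD[OF inc]])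
  also have "\<dots> = (\<Sum>i\<in>UNIV. ennreal (w i) * (\<integral>\<^sup>+x. (SUP n. U n) x \<partial>M i))"
    unfolding SUP_apply
    by (simp add: nn_integral_monotone_convergence_SUP[OF inc meas(2)] SUP_mult_left_ennreal)
  finally show ?case .
qed

lemma finite_measure_mixture:
  fixes M :: "'i::finite \<Rightarrow> 'a::topological_space measure"
  assumes M: "\<And>i. sets (M i) = sets borel" and fin: "\<And>i. finite_measure (M i)"
  shows "finite_measure (mixture w M)"
proof (rule finite_measureI)
  have "emeasure (M i) UNIV \<noteq> \<infinity>" for i
    using finite_measure.emeasure_finite[OF fin] by simp
  then show "emeasure (mixture w M) (space (mixture w M)) \<noteq> \<infinity>"
    by (simp add: emeasure_mixture M ennreal_mult_eq_top_iff)
qed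

lemma integral_mixture_bounded:
  fixes M :: "'i::finite \<Rightarrow> 'a::topological_space measure" and f :: "'a \<Rightarrow> real"
  assumes M: "\<And>i. sets (M i) = sets borel" and fin: "\<And>i. finite_measure (M i)"
    and w: "\<And>i. 0 \<le> w i" and f: "f \<in> borel_measurable borel" and bdd: "bounded (range f)"
  shows "(\<integral>x. f x \<partial>mixture w M) = (\<Sum>i\<in>UNIV. w i * (\<integral>x. f x \<partial>M i))"
proof -
  obtain B where B: "\<And>x. \<bar>f x\<bar> \<le> B" using bdd by (auto simp: bounded_iff)
  have fM: "f \<in> borel_measurable (M i)" "f \<in> borel_measurable (mixture w M)" for i
    using f by (simp_all cong: measurable_cong_sets add: M)
  have int: "integrable (M i) f" "integrable (mixture w M) f" for i
    using B fM fin finite_measure_mixture[OF M fin]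
    by (auto intro!: finite_measure.integrable_const_bound[where B=B])
  \<comment> \<open>Used for \<open>f\<close> and \<open>- f\<close>, where \<open>ennreal\<close>
    keeps the positive and the negative part of \<open>f\<close>. Finiteness of each integral lets
    \<open>enn2real\<close> pass through the sum.\<close>
  have pos: "enn2real (\<integral>\<^sup>+x. ennreal (g x) \<partial>mixture w M)
      = (\<Sum>i\<in>UNIV. w i * enn2real (\<integral>\<^sup>+x. ennreal (g x) \<partial>M i))"
    if g: "g \<in> borel_measurable borel" "\<And>i. integrable (M i) g" for g :: "'a \<Rightarrow> real"
  proof -
    have fin: "(\<integral>\<^sup>+x. ennreal (g x) \<partial>M i) < top" for i
      using g(2)[of i] by (simp add: real_integrable_def less_top)
    have "enn2real (\<Sum>i\<in>UNIV. ennreal (w i) * (\<integral>\<^sup>+x. ennreal (g x) \<partial>M i))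
       = (\<Sum>i\<in>UNIV. enn2real (ennreal (w i) * (\<integral>\<^sup>+x. ennreal (g x) \<partial>M i)))"
      using fin by (subst enn2real_sum) (auto simp: ennreal_mult_less_top)
    then show ?thesis
      using g(1) by (simp add: nn_integral_mixture M enn2real_mult w)
  qed
  show ?thesis
    using pos[of f] pos[of "\<lambda>x. - f x"] int f
    by (simp add: real_lebesgue_integral_def sum_subtractf right_diff_distrib)
qed

section \<open>Finiteness of Gaussian measures\<close>

lemma pos_def_matrix_inv_coercive:
  fixes S :: "real^'n^'n"
  assumes S: "pos_def_matrix S"
  obtains e where "e > 0" "\<And>x. e * (norm x)\<^sup>2 \<le> x \<bullet> (matrix_inv S *v x)"
proof -
  let ?q = "\<lambda>x. x \<bullet> (matrix_inv S *v x)"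
  have "\<exists>B. B ** S = mat 1"
    using S by (auto simp: matrix_left_invertible_ker pos_def_matrix_def)
  then have "invertible S" by (simp add: invertible_left_inverse)
  then have "S ** matrix_inv S = mat 1"
    unfolding invertible_def matrix_inv_def by (metis (mono_tags, lifting) someI_ex)
  then have inv: "S *v (matrix_inv S *v x) = x" for x
    by (simp add: matrix_vector_mul_assoc)
  \<comment> \<open>With \<open>y = matrix_inv S *v x\<close>, which is nonzero, the form equals
    \<open>y \<bullet> (S *v y)\<close>.\<close>
  have pos: "?q x > 0" if "x \<noteq> 0" for x
  proof -
    have "matrix_inv S *v x \<noteq> 0" using that inv[of x] by auto
    then show ?thesis using S inv[of x] by (auto simp: pos_def_matrix_def inner_commute)
  qed
  \<comment> \<open>The constant is the minimum of the form on the unit sphere; homogeneity of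
    degree 2 carries the bound to all vectors.\<close>
  have "continuous_on (sphere 0 1) ?q"
    by (intro continuous_intros matrix_vector_mult_linear_continuous_on)
  moreover have "sphere (0::real^'n) 1 \<noteq> {}" by simp
  ultimately obtain y where y: "y \<in> sphere 0 1" "\<And>x. x \<in> sphere 0 1 \<Longrightarrow> ?q y \<le> ?q x"
    using continuous_attains_inf[OF compact_sphere] by blast
  show thesis
  proof (rule that[of "?q y"])
    show "?q y > 0" using y(1) by (intro pos) auto
    show "?q y * (norm x)\<^sup>2 \<le> ?q x" for x
    proof (cases "x = 0")
      case False
      have "?q y \<le> ?q (x /\<^sub>R norm x)" using False by (intro y(2)) simp
      also have "\<dots> = ?q x / (norm x)\<^sup>2"
        by (simp add: matrix_vector_mult_scaleR power2_eq_square divide_inverse)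
      finally show ?thesis using False by (simp add: field_simps)
    qed simp
  qed
qed

text \<open>The integrand factors over the coordinates, each factor being a multiple of the normal
  density with standard deviation \<open>s\<close>, where
  \<open>2 * s\<^sup>2 = 1 / e\<close>.\<close>

lemma nn_integral_exp_neg_norm_sq_finite:
  assumes "e > 0"
  shows "(\<integral>\<^sup>+x. ennreal (exp (- (e * (norm (x::'a::euclidean_space))\<^sup>2))) \<partial>lborel) < \<infinity>"
proof -
  define s where "s = sqrt (1 / (2 * e))"
  have s: "s > 0" "2 * s\<^sup>2 = 1 / e" using assms by (auto simp: s_def)
  have one: "(\<integral>\<^sup>+t. ennreal (exp (- (e * (t::real)\<^sup>2))) \<partial>lborel) < \<infinity>"
  proof -
    have "exp (- (e * t\<^sup>2)) = sqrt (2 * pi * s\<^sup>2) * normal_density 0 s t" for t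
      using s assms by (simp add: normal_density_def mult.commute)
    then have "integrable lborel (\<lambda>t::real. exp (- (e * t\<^sup>2)))"
      using s by (simp add: integrable_normal_density)
    then show ?thesis by (simp add: real_integrable_def less_top)
  qed
  have "ennreal (exp (- (e * (norm x)\<^sup>2))) = (\<Prod>b\<in>Basis. ennreal (exp (- (e * (x \<bullet> b)\<^sup>2))))" for x :: 'a
  proof -
    have "(norm x)\<^sup>2 = (\<Sum>b\<in>Basis. (x \<bullet> b)\<^sup>2)"
      by (subst power2_norm_eq_inner, subst euclidean_inner) (simp add: power2_eq_square)
    then have "exp (- (e * (norm x)\<^sup>2)) = (\<Prod>b\<in>Basis. exp (- (e * (x \<bullet> b)\<^sup>2)))"
      by (simp add: sum_distrib_left sum_negf[symmetric] exp_sum)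
    then show ?thesis by (simp add: prod_ennreal)
  qed
  then have "(\<integral>\<^sup>+x. ennreal (exp (- (e * (norm (x::'a))\<^sup>2))) \<partial>lborel)
      = (\<integral>\<^sup>+x. (\<Prod>b\<in>Basis. ennreal (exp (- (e * ((x::'a) \<bullet> b)\<^sup>2)))) \<partial>lborel)" by simp
  also have "\<dots> = (\<Prod>b\<in>(Basis::'a set). \<integral>\<^sup>+t. ennreal (exp (- (e * (t::real)\<^sup>2))) \<partial>lborel)"
    by (rule nn_integral_lborel_prod) auto
  also have "\<dots> < \<infinity>" using one by (simp add: power_less_top_ennreal)
  finally show ?thesis .
qed

lemma sets_gaussian [simp, measurable_cong]: "sets (gaussian m S) = sets borel"
  by (simp add: gaussian_def)

text \<open>Coercivity of the inverse covariance dominates the density by a multiple of an isotropic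
  Gaussian. Finite mass makes bounded test functions integrable.\<close>

lemma finite_measure_gaussian:
  fixes m :: "real^'n"
  assumes S: "pos_def_matrix S"
  shows "finite_measure (gaussian m S)"
proof (rule finite_measureI)
  obtain e where e: "e > 0" "\<And>x. e * (norm x)\<^sup>2 \<le> x \<bullet> (matrix_inv S *v x)"
    by (rule pos_def_matrix_inv_coercive[OF S]) blast
  let ?C = "sqrt ((2 * pi) ^ CARD('n) * det S)"
  let ?f = "\<lambda>x. exp (- ((x - m) \<bullet> (matrix_inv S *v (x - m))) / 2) / ?C"
  have "continuous_on UNIV (\<lambda>x. exp (- ((x - m) \<bullet> (matrix_inv S *v (x - m))) / 2))"
    by (intro continuous_intros continuous_on_compose2[OF matrix_vector_mult_linear_continuous_on])
      auto
  then have meas [measurable]: "?f \<in> borel_measurable borel"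
    by (intro borel_measurable_divide borel_measurable_continuous_onI borel_measurable_const)
  let ?g = "\<lambda>x::real^'n. ennreal (exp (- ((e / 2) * (norm x)\<^sup>2)))"
  \<comment> \<open>The absolute value covers either sign of the normalising constant.\<close>
  have "ennreal (?f x) \<le> ennreal \<bar>1 / ?C\<bar> * ?g (x - m)" for x
  proof -
    have "?f x \<le> \<bar>1 / ?C\<bar> * exp (- ((x - m) \<bullet> (matrix_inv S *v (x - m))) / 2)"
      by (simp add: abs_if divide_simps)
    also have "\<dots> \<le> \<bar>1 / ?C\<bar> * exp (- ((e / 2) * (norm (x - m))\<^sup>2))"
      using e(2)[of "x - m"] by (intro mult_left_mono) auto
    finally show ?thesis by (simp add: ennreal_mult[symmetric] ennreal_leI)
  qed
  then have "(\<integral>\<^sup>+x. ennreal (?f x) \<partial>lborel) \<le> (\<integral>\<^sup>+x. ennreal \<bar>1 / ?C\<bar> * ?g (x - m) \<partial>lborel)"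
    by (rule nn_integral_mono)
  also have "\<dots> = ennreal \<bar>1 / ?C\<bar> * (\<integral>\<^sup>+x. ?g (x - m) \<partial>lborel)"
    by (rule nn_integral_cmult) simp
  \<comment> \<open>Translation invariance of Lebesgue measure.\<close>
  also have "(\<integral>\<^sup>+x. ?g (x - m) \<partial>lborel) = (\<integral>\<^sup>+x. ?g x \<partial>lborel)"
    by (subst lborel_distr_plus[of "- m", symmetric], subst nn_integral_distr) simp_all
  also have "ennreal \<bar>1 / ?C\<bar> * (\<integral>\<^sup>+x. ?g x \<partial>lborel) < \<infinity>"
    using nn_integral_exp_neg_norm_sq_finite[of "e / 2", where 'a="real^'n"] e(1) by (simp add: ennreal_mult_less_top)
  finally have "(\<integral>\<^sup>+x. ennreal (?f x) \<partial>lborel) < \<infinity>" .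
  moreover have "emeasure (gaussian m S) (space (gaussian m S)) = (\<integral>\<^sup>+x. ennreal (?f x) \<partial>lborel)"
    using meas by (simp add: gaussian_def emeasure_density)
  ultimately show "emeasure (gaussian m S) (space (gaussian m S)) \<noteq> \<infinity>" by simp
qed

section \<open>Graph plans of the Gaussian maps and narrow convergence\<close>

lemma continuous_on_gaussian_map: "continuous_on UNIV (gaussian_map m0 S0 m1 S1)"
  unfolding gaussian_map_def[abs_def] Let_def
  by (intro continuous_intros continuous_on_compose2[OF matrix_vector_mult_linear_continuous_on]) auto

lemma finite_measure_graph_plan:
  assumes "pos_def_matrix S0"
  shows "finite_measure (distr (gaussian m0 S0) borel (\<lambda>x. (x, gaussian_map m0 S0 m1 S1 x)))"
proof (intro finite_measure.finite_measure_distr finite_measure_gaussian assms)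
  have "(\<lambda>x. (x, gaussian_map m0 S0 m1 S1 x)) \<in> borel_measurable borel"
    by (intro borel_measurable_continuous_onI continuous_on_Pair continuous_on_gaussian_map
        continuous_on_id)
  then show "(\<lambda>x. (x, gaussian_map m0 S0 m1 S1 x)) \<in> borel_measurable (gaussian m0 S0)"
    by (simp cong: measurable_cong_sets)
qed

lemma finite_measure_induced_plan:
  assumes "\<And>k. pos_def_matrix (S0 k)"
  shows "finite_measure (induced_plan m0 S0 m1 S1 \<omega>)"
  unfolding induced_plan_def
  by (rule finite_measure_mixture) (auto intro: finite_measure_graph_plan assms)

lemma integral_induced_plan:
  fixes \<omega> :: "real^'l^'k"
  assumes S0: "\<And>k. pos_def_matrix (S0 k)" and \<omega>: "\<And>k l. 0 \<le> \<omega> $ k $ l"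
    and \<phi>: "continuous_on UNIV \<phi>" "bounded (range (\<phi> :: _ \<Rightarrow> real))"
  shows "(\<integral>z. \<phi> z \<partial>induced_plan m0 S0 m1 S1 \<omega>) = (\<Sum>(k, l)\<in>UNIV. \<omega> $ k $ l *
    (\<integral>z. \<phi> z \<partial>distr (gaussian (m0 k) (S0 k)) borel
      (\<lambda>x. (x, gaussian_map (m0 k) (S0 k) (m1 l) (S1 l) x))))"
  unfolding induced_plan_def
  by (subst integral_mixture_bounded)
    (auto intro: finite_measure_graph_plan S0 \<omega> \<phi> borel_measurable_continuous_onI
      simp: case_prod_unfold)

lemma induced_plan_narrowly_tendsto:
  fixes S0 :: "'k::finite \<Rightarrow> real^'n^'n" and w0 :: "real^'l^'k"
  assumes S0: "\<And>k. pos_def_matrix (S0 k)"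
    and lim: "(w \<longlongrightarrow> w0) F" and w: "\<forall>\<^sub>F i in F. \<forall>k l. 0 \<le> w i $ k $ l"
    and w0: "\<And>k l. 0 \<le> w0 $ k $ l"
  shows "narrowly_tendsto (\<lambda>i. induced_plan m0 S0 m1 S1 (w i)) (induced_plan m0 S0 m1 S1 w0) F"
  unfolding narrowly_tendsto_def
proof (intro allI impI)
  fix \<phi> :: "(real^'n) \<times> (real^'n) \<Rightarrow> real" assume \<phi>: "continuous_on UNIV \<phi>" "bounded (range \<phi>)"
  let ?I = "\<lambda>k l. \<integral>z. \<phi> z \<partial>distr (gaussian (m0 k) (S0 k)) borel
      (\<lambda>x. (x, gaussian_map (m0 k) (S0 k) (m1 l) (S1 l) x))"
  have "((\<lambda>i. \<Sum>(k, l)\<in>UNIV. w i $ k $ l * ?I k l) \<longlongrightarrow> (\<Sum>(k, l)\<in>UNIV. w0 $ k $ l * ?I k l)) F"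
    unfolding case_prod_unfold by (intro tendsto_intros lim)
  \<comment> \<open>In \<open>mixture\<close>, \<open>ennreal\<close> truncates negative weights to
    0, so the linear formula is applied only where the weights are nonnegative, which is eventually
    along \<open>F\<close>.\<close>
  then show "((\<lambda>i. \<integral>z. \<phi> z \<partial>induced_plan m0 S0 m1 S1 (w i))
      \<longlongrightarrow> (\<integral>z. \<phi> z \<partial>induced_plan m0 S0 m1 S1 w0)) F"
    unfolding integral_induced_plan[OF S0 w0 \<phi>]
    by (rule Lim_transform_eventually)
      (use w in eventually_elim, simp add: integral_induced_plan[OF S0 _ \<phi>])
qed

section \<open>The iterated limit of the induced plans\<close>

theorem theorem4p3:
  fixes a :: "real^'k" and b :: "real^'l"
    and m0 :: "'k \<Rightarrow> real^'n" and S0 :: "'k \<Rightarrow> real^'n^'n"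
    and m1 :: "'l \<Rightarrow> real^'n" and S1 :: "'l \<Rightarrow> real^'n^'n"
    and \<mu>c :: "'k \<Rightarrow> (real^'n) measure" and \<nu>c :: "'l \<Rightarrow> (real^'n) measure"
    and \<mu> \<nu> :: "(real^'n) measure"
    and c \<omega>star :: "real^'l^'k" and \<omega> :: "real \<Rightarrow> real \<Rightarrow> real^'l^'k"
    and \<gamma> :: "real \<Rightarrow> real \<Rightarrow> ((real^'n) \<times> (real^'n)) measure"
    and \<gamma>star :: "((real^'n) \<times> (real^'n)) measure"
  assumes a: "\<And>k. a $ k > 0" "(\<Sum>k\<in>UNIV. a $ k) = 1"
    and b: "\<And>l. b $ l > 0" "(\<Sum>l\<in>UNIV. b $ l) = 1"
    and S0: "\<And>k. pos_def_matrix (S0 k)" and S1: "\<And>l. pos_def_matrix (S1 l)"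
  defines "\<mu>c \<equiv> \<lambda>k. gaussian (m0 k) (S0 k)" and "\<nu>c \<equiv> \<lambda>l. gaussian (m1 l) (S1 l)"
    and "\<mu> \<equiv> mixture (\<lambda>k. a $ k) \<mu>c" and "\<nu> \<equiv> mixture (\<lambda>l. b $ l) \<nu>c"
    and "c \<equiv> \<chi> k l. (W2 (\<mu>c k) (\<nu>c l))\<^sup>2"
    and "\<omega> \<equiv> \<lambda>\<epsilon> lam. epot_real_block a b c \<epsilon> lam"
    and "\<omega>star \<equiv> max_entropy_minimizer a b c"
    and "\<gamma> \<equiv> \<lambda>\<epsilon> lam. induced_plan m0 S0 m1 S1 (\<omega> \<epsilon> lam)"
    and "\<gamma>star \<equiv> induced_plan m0 S0 m1 S1 \<omega>star"
  shows "(\<forall>\<phi> :: (real^'n) \<times> (real^'n) \<Rightarrow> real. continuous_on UNIV \<phi> \<longrightarrow> bounded (range \<phi>) \<longrightarrow>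
           (\<exists>I. (\<forall>\<epsilon>>0. ((\<lambda>lam. \<integral>z. \<phi> z \<partial>\<gamma> \<epsilon> lam) \<longlongrightarrow> I \<epsilon>) at_top) \<and>
                (I \<longlongrightarrow> (\<integral>z. \<phi> z \<partial>\<gamma>star)) (at_right 0)))
       \<and> (\<exists>\<gamma>lim. (\<forall>\<epsilon>>0. finite_measure (\<gamma>lim \<epsilon>) \<and> sets (\<gamma>lim \<epsilon>) = sets borel \<and>
                          narrowly_tendsto (\<gamma> \<epsilon>) (\<gamma>lim \<epsilon>) at_top) \<and>
                 narrowly_tendsto \<gamma>lim \<gamma>star (at_right 0))"
proof -
  have ne: "transport_polytope a b \<noteq> {}"
    using a b by (intro transport_polytope_nonempty) (auto intro: less_imp_le)
  let ?f = "\<lambda>\<epsilon> z. transport_cost c z + \<epsilon> * entropy_functional z"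
  \<comment> \<open>The entropic transport plan without dummies, to which the real blocks converge
    as \<lambda> \<rightarrow> \<infinity>.\<close>
  have "\<exists>w. w \<in> transport_polytope a b \<and>
      (\<forall>z\<in>transport_polytope a b. z \<noteq> w \<longrightarrow> ?f \<epsilon> w < ?f \<epsilon> z)" if "\<epsilon> > 0" for \<epsilon>
    by (rule entropic_minimizer_unique[OF compact_transport_polytope convex_transport_polytope ne
          transport_polytope_nonneg that, where c=c]) auto
  then obtain w where w: "\<And>\<epsilon>. \<epsilon> > 0 \<Longrightarrow> w \<epsilon> \<in> transport_polytope a b"
    "\<And>\<epsilon> z. \<epsilon> > 0 \<Longrightarrow> z \<in> transport_polytope a b \<Longrightarrow> z \<noteq> w \<epsilon> \<Longrightarrow> ?f \<epsilon> (w \<epsilon>) < ?f \<epsilon> z"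
    by metis
  define \<gamma>lim where "\<gamma>lim \<epsilon> = induced_plan m0 S0 m1 S1 (w \<epsilon>)" for \<epsilon>
  have inner: "narrowly_tendsto (\<gamma> \<epsilon>) (\<gamma>lim \<epsilon>) at_top" if "\<epsilon> > 0" for \<epsilon>
    unfolding \<gamma>_def \<gamma>lim_def
  proof (rule induced_plan_narrowly_tendsto[OF S0])
    \<comment> \<open>Extracting the real block is continuous and undoes
      \<open>pad_plan\<close>.\<close>
    have "((\<lambda>lam. \<chi> k l. epot_minimizer a b c \<epsilon> lam $ Some k $ Some l)
        \<longlongrightarrow> (\<chi> k l. pad_plan (w \<epsilon>) $ Some k $ Some l)) at_top"
      by (intro tendsto_intros epot_minimizer_tendsto[OF a(2) b(2) w(1)[OF that] w(2)[OF that]])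
    then show "(\<omega> \<epsilon> \<longlongrightarrow> w \<epsilon>) at_top"
      by (simp add: \<omega>_def epot_real_block_def[abs_def])
    show "\<forall>\<^sub>F lam in at_top. \<forall>k l. 0 \<le> \<omega> \<epsilon> lam $ k $ l"
      by (simp add: \<omega>_def epot_real_block_def
          transport_polytope_nonneg[OF epot_minimizer_minimizes(1)[OF ne]])
    show "\<And>k l. 0 \<le> w \<epsilon> $ k $ l" by (rule transport_polytope_nonneg[OF w(1)[OF that]])
  qed
  have outer: "narrowly_tendsto \<gamma>lim \<gamma>star (at_right 0)"
    unfolding \<gamma>star_def \<gamma>lim_def[abs_def]
  proof (rule induced_plan_narrowly_tendsto[OF S0])
    show "(w \<longlongrightarrow> \<omega>star) (at_right 0)"
      unfolding \<omega>star_def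
      by (rule entropic_ot_tendsto_max_entropy[OF ne w(1)]) (auto intro: less_imp_le dest: w(2))
    show "\<forall>\<^sub>F \<epsilon> in at_right 0. \<forall>k l. 0 \<le> w \<epsilon> $ k $ l"
      using eventually_at_right_less[of "0::real"]
      by eventually_elim (auto intro: transport_polytope_nonneg w(1))
    show "\<And>k l. 0 \<le> \<omega>star $ k $ l"
      using max_entropy_minimizer_strict(1)[OF ne, of c]
      by (auto simp: \<omega>star_def ot_minimizers_eq intro: transport_polytope_nonneg)
  qed
  have "finite_measure (\<gamma>lim \<epsilon>)" "sets (\<gamma>lim \<epsilon>) = sets borel" for \<epsilon>
    unfolding \<gamma>lim_def by (rule finite_measure_induced_plan[OF S0]) (simp add: induced_plan_def)
  with inner outer have "\<exists>\<gamma>lim. (\<forall>\<epsilon>>0. finite_measure (\<gamma>lim \<epsilon>) \<and> sets (\<gamma>lim \<epsilon>) = sets borel \<and>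
        narrowly_tendsto (\<gamma> \<epsilon>) (\<gamma>lim \<epsilon>) at_top) \<and> narrowly_tendsto \<gamma>lim \<gamma>star (at_right 0)"
    by blast
  \<comment> \<open>The inner limit of the integrals is the integral against
    \<open>\<gamma>lim \<epsilon>\<close>.\<close>
  moreover have "\<exists>I. (\<forall>\<epsilon>>0. ((\<lambda>lam. \<integral>z. \<phi> z \<partial>\<gamma> \<epsilon> lam) \<longlongrightarrow> I \<epsilon>) at_top) \<and>
        (I \<longlongrightarrow> (\<integral>z. \<phi> z \<partial>\<gamma>star)) (at_right 0)"
    if "continuous_on UNIV \<phi>" "bounded (range \<phi>)" for \<phi> :: "(real^'n) \<times> (real^'n) \<Rightarrow> real"
    using that inner outer unfolding narrowly_tendsto_def
    by (intro exI[of _ "\<lambda>\<epsilon>. \<integral>z. \<phi> z \<partial>\<gamma>lim \<epsilon>"]) auto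
  ultimately show ?thesis by blast
qed

end
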